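(* Let $a,b$ be positive integers and let $G$ be a finite $(a,b)$--biregular bipartite graph. Then $$\lambda_G(p)\geq\mathcal{G}_{a,b}(p)$$ for every $0\leq p\leq\min\left(\frac{a}{a+b},\frac{b}{a+b}\right)$.
   Context: An $(a,b)$--biregular bipartite graph has bipartition $(A,B)$ with all vertices of $A$ of degree $a$ and all of $B$ of degree $b$. $H(q)=-(q\ln q+(1-q)\ln(1-q))$, $H(0)=H(1)=0$, and $\mathcal{G}_{a,b}(p)=\frac{a}{a+b}H\left(\frac{a+b}{2a}p\right)+\frac{b}{a+b}H\left(\frac{a+b}{2b}p\right)+\frac12p\ln(ab)-\frac{ab}{a+b}H\left(\frac{a+b}{2ab}p\right)$. For a finite graph $G$ with $m_k(G)$ matchings of size $k$, $M(G,t)=\sum_km_k(G)t^k$, $p(G,t)=\frac{2t\,\frac{d}{dt}M(G,t)}{v(G)M(G,t)}$ ($t\geq0$); with $\nu(G)$ the maximum matching size and $p^*=2\nu(G)/v(G)$, $p(G,\cdot)$ is a strictly increasing bijection $[0,\infty)\to[0,p^* )$ with inverse $t(G,p)$; $\lambda_G(p)=\frac{\ln M(G,t(G,p))}{v(G)}-\frac12p\ln t(G,p)$ for $0\leq p<p^*$ (value $0$ at $p=0$), $\lambda_G(p^* )=\lim_{p\nearrow p^*}\lambda_G(p)$, $\lambda_G(p)=0$ for $p>p^*$. *)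

theory Defs
  imports "HOL-Analysis.Analysis"
begin

definition simple_graph :: "'a set \<Rightarrow> 'a set set \<Rightarrow> bool" where
  "simple_graph V E \<longleftrightarrow> finite V \<and> (\<forall>e\<in>E. e \<subseteq> V \<and> card e = 2)"

definition degree :: "'a set set \<Rightarrow> 'a \<Rightarrow> nat" where
  "degree E v = card {e\<in>E. v \<in> e}"

definition biregular_bipartite ::
    "'a set \<Rightarrow> 'a set set \<Rightarrow> 'a set \<Rightarrow> 'a set \<Rightarrow> nat \<Rightarrow> nat \<Rightarrow> bool" where
  "biregular_bipartite V E A B a b \<longleftrightarrow>
     simple_graph V E \<and> A \<union> B = V \<and> A \<inter> B = {} \<and>
     (\<forall>e\<in>E. \<exists>x\<in>A. \<exists>y\<in>B. e = {x, y}) \<and>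
     (\<forall>v\<in>A. degree E v = a) \<and> (\<forall>v\<in>B. degree E v = b)"

definition matching :: "'a set set \<Rightarrow> 'a set set \<Rightarrow> bool" where
  "matching E M \<longleftrightarrow> M \<subseteq> E \<and> (\<forall>e\<in>M. \<forall>f\<in>M. e \<noteq> f \<longrightarrow> e \<inter> f = {})"

definition num_matchings :: "'a set set \<Rightarrow> nat \<Rightarrow> nat" where
  "num_matchings E k = card {M. matching E M \<and> card M = k}"

definition match_poly :: "'a set set \<Rightarrow> real \<Rightarrow> real" where
  "match_poly E t = (\<Sum>k\<le>card E. real (num_matchings E k) * t ^ k)"

definition p_fun :: "'a set \<Rightarrow> 'a set set \<Rightarrow> real \<Rightarrow> real" where
  "p_fun V E t = 2 * t * deriv (match_poly E) t / (real (card V) * match_poly E t)"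

definition max_matching :: "'a set set \<Rightarrow> nat" where
  "max_matching E = Max {card M | M. matching E M}"

definition p_star :: "'a set \<Rightarrow> 'a set set \<Rightarrow> real" where
  "p_star V E = 2 * real (max_matching E) / real (card V)"

text \<open>inverse t(G,p) of p(G,.) on [0, p*)\<close>
definition t_fun :: "'a set \<Rightarrow> 'a set set \<Rightarrow> real \<Rightarrow> real" where
  "t_fun V E p = (THE t. t \<ge> 0 \<and> p_fun V E t = p)"

definition lambda_open :: "'a set \<Rightarrow> 'a set set \<Rightarrow> real \<Rightarrow> real" where
  "lambda_open V E p =
     ln (match_poly E (t_fun V E p)) / real (card V) - p / 2 * ln (t_fun V E p)"

definition lambda_G :: "'a set \<Rightarrow> 'a set set \<Rightarrow> real \<Rightarrow> real" where
  "lambda_G V E p =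
     (if p = 0 then 0
      else if 0 < p \<and> p < p_star V E then lambda_open V E p
      else if p = p_star V E then Lim (at_left (p_star V E)) (lambda_open V E)
      else 0)"

definition H_ent :: "real \<Rightarrow> real" where
  "H_ent q = (if q = 0 \<or> q = 1 then 0 else - (q * ln q + (1 - q) * ln (1 - q)))"

definition G_ab :: "nat \<Rightarrow> nat \<Rightarrow> real \<Rightarrow> real" where
  "G_ab a b p =
     real a / real (a + b) * H_ent (real (a + b) / (2 * real a) * p)
   + real b / real (a + b) * H_ent (real (a + b) / (2 * real b) * p)
   + 1/2 * p * ln (real a * real b)
   - real a * real b / real (a + b) * H_ent (real (a + b) / (2 * real a * real b) * p)"

end

theory Submission
  imports Defs
begin

text \<open>
  Put \<open>\<alpha> = p (a + b) / (2 a b)\<close>, the edge density of a matching with \<open>p v(G) / 2\<close> edges. The core is the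
  bound \<open>M(G,t) \<ge> t powr (p v(G) / 2) * exp (v(G) G_ab p)\<close> for every \<open>t > 0\<close>. Start from the
  edgeless graph, where a vertex of weight \<open>x\<close> contributes just \<open>x\<close>, and glue in the edges one at
  a time. An edge \<open>uw\<close> is compared with two independent half-edges of weights \<open>y\<close> and \<open>z\<close>, i.e.
  with increasing the weights of \<open>u\<close> and \<open>w\<close> by \<open>y\<close> and \<open>z\<close>. In a bipartite graph the events that
  \<open>u\<close> and \<open>w\<close> are uncovered are positively correlated, and this makes the loss at most a factor
  depending only on \<open>\<alpha>\<close> and \<open>t\<close>, by the weighted AM-GM inequality, for a suitable choice of \<open>y, z\<close>.

  At \<open>t = t(G,p)\<close> the bound is the theorem. Its growth as \<open>t\<close> tends to infinity, for a parameter
  slightly larger than \<open>p\<close>, also shows \<open>p < p*\<close>, so that \<open>t(G,p)\<close> exists and is positive.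
\<close>

section \<open>Weighted monomer-dimer sums\<close>

text \<open>Partition function with edge activity \<open>t\<close> and monomer weights
  \<open>x\<close>. The vertex set \<open>U\<close> is a separate argument, so that deleting
  vertices leaves \<open>F\<close> untouched: edges not inside \<open>U\<close> simply never
  occur.\<close>

definition monomer_dimer :: "('v \<Rightarrow> real) \<Rightarrow> real \<Rightarrow> 'v set set \<Rightarrow> 'v set \<Rightarrow> real" where
  "monomer_dimer x t F U = (\<Sum>M | matching F M \<and> \<Union>M \<subseteq> U. t ^ card M * (\<Prod>v\<in>U - \<Union>M. x v))"

lemma finite_matchings: "finite F \<Longrightarrow> finite {M. matching F M \<and> P M}"
  by (rule finite_subset[of _ "Pow F"]) (auto simp: matching_def)

lemma matching_empty_iff: "matching {} M \<longleftrightarrow> M = {}"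
  by (auto simp: matching_def)

lemma monomer_dimer_empty: "monomer_dimer x t {} U = (\<Prod>v\<in>U. x v)"
proof -
  have "{M. matching {} M \<and> \<Union>M \<subseteq> U} = {{}}"
    by (auto simp: matching_empty_iff)
  then show ?thesis by (simp add: monomer_dimer_def)
qed

text \<open>A matching either avoids \<open>e\<close>, or contains it, and then
  \<open>M - {e}\<close> ranges over the matchings inside \<open>U - e\<close>. The inductions over
  the edge set run on this recursion.\<close>

lemma monomer_dimer_insert:
  fixes e :: "'v set"
  assumes "finite F" "e \<notin> F" "e \<noteq> {}"
  shows "monomer_dimer x t (insert e F) U =
    monomer_dimer x t F U + (if e \<subseteq> U then t * monomer_dimer x t F (U - e) else 0)"
proof -
  let ?w = "\<lambda>U M. t ^ card M * (\<Prod>v\<in>U - \<Union>M. x v)"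
  let ?N = "{M. matching F M \<and> \<Union>M \<subseteq> U}"
  let ?C = "{M. matching (insert e F) M \<and> \<Union>M \<subseteq> U \<and> e \<in> M}"
  let ?D = "{M. matching F M \<and> \<Union>M \<subseteq> U - e}"
  have split: "{M. matching (insert e F) M \<and> \<Union>M \<subseteq> U} = ?N \<union> ?C"
    using assms(2) unfolding matching_def set_eq_iff Un_iff mem_Collect_eq by blast
  have disj: "?N \<inter> ?C = {}"
  proof (rule equals0I)
    fix M assume M: "M \<in> ?N \<inter> ?C"
    then have "M \<subseteq> F" "e \<in> M" unfolding matching_def by simp_all
    then show False using assms(2) by blast
  qed
  have fin: "finite ?N" "finite ?C" "finite ?D"
    using assms(1) by (auto intro: finite_matchings)
  have sumC: "sum (?w U) ?C = (if e \<subseteq> U then t * sum (?w (U - e)) ?D else 0)"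
  proof (cases "e \<subseteq> U")
    case False
    then have "?C = {}" by (simp add: Sup_le_iff) blast
    then show ?thesis using False by (simp only: sum.empty if_False)
  next
    case True
    have img: "?C = insert e ` ?D"
    proof (intro subset_antisym subsetI)
      fix M assume M: "M \<in> ?C"
      have "matching F (M - {e})"
        using M by (simp add: matching_def subset_insert_iff)
      moreover have "\<Union>(M - {e}) \<subseteq> U - e"
      proof
        fix v assume "v \<in> \<Union>(M - {e})"
        then obtain f where f: "f \<in> M" "f \<noteq> e" "v \<in> f" by blast
        have "f \<inter> e = {}" using M f(1,2) by (simp add: matching_def)
        moreover have "v \<in> U" using M f(1,3) by blast
        ultimately show "v \<in> U - e" using f(3) by blast
      qed
      ultimately have "M - {e} \<in> ?D" by simp
      moreover have "M = insert e (M - {e})" using M by auto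
      ultimately show "M \<in> insert e ` ?D" by (rule rev_image_eqI)
    next
      fix M assume "M \<in> insert e ` ?D"
      then obtain N where "N \<in> ?D" "M = insert e N" by (rule imageE)
      then have N: "matching F N" "\<Union>N \<subseteq> U - e" "M = insert e N" by simp_all
      have d: "\<forall>f\<in>N. e \<inter> f = {} \<and> f \<inter> e = {}" using N(2) by blast
      have "N \<subseteq> F" using N(1) by (simp add: matching_def)
      then have "M \<subseteq> insert e F" using N(3) by blast
      moreover have "\<forall>f\<in>M. \<forall>g\<in>M. f \<noteq> g \<longrightarrow> f \<inter> g = {}"
        using N(1) d unfolding N(3) by (simp add: matching_def)
      moreover have "\<Union>M \<subseteq> U" using N(2) True unfolding N(3) by blast
      ultimately show "M \<in> ?C" using N(3) by (simp add: matching_def)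
    qed
    have notin: "e \<notin> N" if "N \<in> ?D" for N
      using that assms(2) by (auto simp: matching_def)
    have inj: "inj_on (insert e) ?D"
    proof (rule inj_onI)
      fix N N' assume "N \<in> ?D" "N' \<in> ?D" "insert e N = insert e N'"
      then show "N = N'" using notin[of N] notin[of N'] insert_ident by metis
    qed
    have "sum (?w U) ?C = (\<Sum>N\<in>?D. ?w U (insert e N))"
      unfolding img by (simp add: sum.reindex[OF inj])
    also have "\<dots> = (\<Sum>N\<in>?D. t * ?w (U - e) N)"
    proof (rule sum.cong[OF refl])
      fix N assume N: "N \<in> ?D"
      then have "N \<subseteq> F" by (auto simp: matching_def)
      then have "finite N" using assms(1) finite_subset by blast
      moreover have "U - \<Union>(insert e N) = U - e - \<Union>N" by auto
      ultimately show "?w U (insert e N) = t * ?w (U - e) N"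
        using notin[OF N] by simp
    qed
    finally show ?thesis using True by (simp add: sum_distrib_left)
  qed
  have "monomer_dimer x t (insert e F) U = sum (?w U) ?N + sum (?w U) ?C"
    unfolding monomer_dimer_def split by (rule sum.union_disjoint[OF fin(1,2) disj])
  then show ?thesis unfolding sumC by (simp only: monomer_dimer_def)
qed

text \<open>Either \<open>u\<close> is uncovered and contributes \<open>x u\<close>, or it is
  covered by exactly one edge \<open>e\<close>. The induction keeps \<open>U\<close> arbitrary
  because an edge away from \<open>u\<close> calls for the expansion on \<open>U - f\<close> as
  well.\<close>

lemma monomer_dimer_vertex:
  assumes "finite F" "finite U" "{} \<notin> F" "u \<in> U"
  shows "monomer_dimer x t F U = x u * monomer_dimer x t F (U - {u})
    + (\<Sum>e | e \<in> F \<and> u \<in> e \<and> e \<subseteq> U. t * monomer_dimer x t F (U - e))"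
  using assms
proof (induction F arbitrary: U rule: finite_induct)
  case empty
  then show ?case by (simp add: monomer_dimer_empty prod.remove)
next
  case (insert f F)
  have f: "f \<noteq> {}" "{} \<notin> F" using insert.prems by auto
  let ?Z = "monomer_dimer x t F" and ?Z' = "monomer_dimer x t (insert f F)"
  let ?S = "\<lambda>U. {e. e \<in> F \<and> u \<in> e \<and> e \<subseteq> U}"
  have rec: "?Z' W = ?Z W + (if f \<subseteq> W then t * ?Z (W - f) else 0)" for W
    by (rule monomer_dimer_insert) (use insert.hyps f in auto)
  have fin: "finite (?S U)" for U using insert.hyps(1) by simp
  have comm: "U - f - W = U - W - f" for W by blast
  have IH: "?Z U = x u * ?Z (U - {u}) + (\<Sum>e\<in>?S U. t * ?Z (U - e))"
    using insert.IH[of U] insert.prems f by auto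
  show ?case
  proof (cases "u \<in> f \<or> \<not> f \<subseteq> U")
    \<comment> \<open>Here \<open>f\<close> lies in none of the sets \<open>U - {u}\<close> and
      \<open>U - e\<close> with \<open>u \<in> e\<close>, so it affects at most the single summand
      \<open>e = f\<close>.\<close>
    case True
    have 1: "?Z' (U - {u}) = ?Z (U - {u})" using True by (auto simp: rec)
    have 2: "?Z' (U - e) = ?Z (U - e)" if "u \<in> e" for e
      using True that by (auto simp: rec)
    have S: "(\<Sum>e | e \<in> insert f F \<and> u \<in> e \<and> e \<subseteq> U. t * ?Z' (U - e))
      = (\<Sum>e | e \<in> insert f F \<and> u \<in> e \<and> e \<subseteq> U. t * ?Z (U - e))"
      by (rule sum.cong) (auto simp: 2)
    show ?thesis
    proof (cases "f \<subseteq> U")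
      case True
      with \<open>u \<in> f \<or> \<not> f \<subseteq> U\<close>
      have "{e. e \<in> insert f F \<and> u \<in> e \<and> e \<subseteq> U} = insert f (?S U)" by auto
      moreover have "f \<notin> ?S U" using insert.hyps by simp
      ultimately show ?thesis using True fin[of U] IH S 1 rec[of U] by simp
    next
      case False
      then have "{e. e \<in> insert f F \<and> u \<in> e \<and> e \<subseteq> U} = ?S U" by auto
      then show ?thesis using False IH S 1 rec[of U] by simp
    qed
  next
    \<comment> \<open>Here \<open>f\<close> contributes \<open>t\<close> times the whole expansion
      on \<open>U - f\<close>; in the sum over edges at \<open>u\<close> this extra part comes from
      the edges \<open>e\<close> disjoint from \<open>f\<close>.\<close>
    case False
    then have f': "u \<notin> f" "f \<subseteq> U" by auto
    have "{e. e \<in> insert f F \<and> u \<in> e \<and> e \<subseteq> U} = ?S U" using f' by auto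
    moreover have "(\<Sum>e\<in>?S U. t * ?Z' (U - e)) = (\<Sum>e\<in>?S U. t * ?Z (U - e))
      + t * (\<Sum>e\<in>?S (U - f). t * ?Z (U - f - e))"
    proof -
      have sub: "?S (U - f) = {e \<in> ?S U. f \<subseteq> U - e}" using f' by auto
      have "(\<Sum>e\<in>?S (U - f). t * ?Z (U - f - e))
        = (\<Sum>e\<in>?S U. if f \<subseteq> U - e then t * ?Z (U - f - e) else 0)"
        unfolding sub using fin[of U] by (simp only: sum.inter_filter)
      then have "(\<Sum>e\<in>?S U. t * ?Z (U - e)) + t * (\<Sum>e\<in>?S (U - f). t * ?Z (U - f - e))
        = (\<Sum>e\<in>?S U. t * ?Z (U - e) + t * (if f \<subseteq> U - e then t * ?Z (U - f - e) else 0))"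
        by (simp only: sum.distrib sum_distrib_left)
      also have "\<dots> = (\<Sum>e\<in>?S U. t * ?Z' (U - e))"
        by (rule sum.cong) (simp_all add: rec comm algebra_simps)
      finally show ?thesis by simp
    qed
    moreover have "?Z (U - f) = x u * ?Z (U - f - {u}) + (\<Sum>e\<in>?S (U - f). t * ?Z (U - f - e))"
      using insert.IH[of "U - f"] insert.prems f f' by auto
    moreover have "?Z' (U - {u}) = ?Z (U - {u}) + t * ?Z (U - f - {u})"
      using f' rec[of "U - {u}"] by (auto simp: comm)
    ultimately show ?thesis
      using f' IH rec[of U] by (simp add: algebra_simps)
  qed
qed

lemma monomer_dimer_pos:
  assumes "finite F" "finite U" "{} \<notin> F" "t > 0" "\<And>v. v \<in> U \<Longrightarrow> x v > 0"
  shows "monomer_dimer x t F U > 0"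
  using assms
proof (induction F arbitrary: U rule: finite_induct)
  case empty
  then show ?case by (simp add: monomer_dimer_empty prod_pos)
next
  case (insert f F)
  have "monomer_dimer x t F U > 0" "monomer_dimer x t F (U - f) > 0"
    using insert by auto
  moreover have "f \<noteq> {}" using insert.prems by auto
  ultimately show ?case
    using insert.prems insert.hyps by (simp add: monomer_dimer_insert add_pos_pos)
qed

lemma monomer_dimer_cong:
  assumes "\<And>v. v \<in> U \<Longrightarrow> x v = y v"
  shows "monomer_dimer x t F U = monomer_dimer y t F U"
  unfolding monomer_dimer_def using assms by (auto intro!: sum.cong prod.cong)

text \<open>In the expansion at \<open>u\<close> the weight \<open>x u\<close> occurs only in the
  first term, so the sum is affine in it. This is the effect of attaching a half-edge of weight
  \<open>y\<close> at \<open>u\<close>.\<close>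

lemma monomer_dimer_upd_add:
  assumes "finite F" "finite U" "{} \<notin> F" "u \<in> U"
  shows "monomer_dimer (x(u := x u + y)) t F U
    = monomer_dimer x t F U + y * monomer_dimer x t F (U - {u})"
proof -
  let ?x = "x(u := x u + y)"
  have c: "monomer_dimer ?x t F (U - e) = monomer_dimer x t F (U - e)" if "u \<in> e" for e
    by (rule monomer_dimer_cong) (use that in auto)
  have "(\<Sum>e | e \<in> F \<and> u \<in> e \<and> e \<subseteq> U. t * monomer_dimer ?x t F (U - e))
    = (\<Sum>e | e \<in> F \<and> u \<in> e \<and> e \<subseteq> U. t * monomer_dimer x t F (U - e))"
    by (rule sum.cong) (auto simp: c)
  then show ?thesis
    using monomer_dimer_vertex[OF assms, of x t] monomer_dimer_vertex[OF assms, of ?x t]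
      c[of "{u}"] by (simp add: algebra_simps)
qed

section \<open>Correlation of two uncovered vertices\<close>

text \<open>The two sign patterns are proved together: expanding at \<open>u\<close> reduces either one to the
  other on \<open>U - {u}\<close>, because a neighbour of \<open>u\<close> lies on the opposite side.\<close>
lemma monomer_dimer_correlation:
  assumes "finite F" "A \<inter> B = {}" "t > 0"
    and bip: "\<And>e. e \<in> F \<Longrightarrow> \<exists>x\<in>A. \<exists>y\<in>B. e = {x, y}"
    and "finite U" "\<And>v. v \<in> U \<Longrightarrow> x v > 0"
    and "U \<subseteq> A \<union> B" "u \<in> U" "w \<in> U" "u \<noteq> w"
  shows "if (u \<in> A) = (w \<in> A)
    then monomer_dimer x t F U * monomer_dimer x t F (U - {u, w})
       \<le> monomer_dimer x t F (U - {u}) * monomer_dimer x t F (U - {w})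
    else monomer_dimer x t F U * monomer_dimer x t F (U - {u, w})
       \<ge> monomer_dimer x t F (U - {u}) * monomer_dimer x t F (U - {w})"
  using assms(5-)
proof (induction "card U" arbitrary: U u w rule: less_induct)
  case less
  let ?Z = "monomer_dimer x t F"
  let ?S = "\<lambda>U. {e. e \<in> F \<and> u \<in> e \<and> e \<subseteq> U}"
  have ne: "{} \<notin> F" using bip by blast
  have fin: "finite (?S U)" for U using assms(1) by simp
  note vertex = monomer_dimer_vertex[OF assms(1) _ ne, where x = x and t = t and u = u]
  have ZU: "?Z U = x u * ?Z (U - {u}) + (\<Sum>e\<in>?S U. t * ?Z (U - e))"
    using vertex[of U] less.prems by auto
  have Zw: "?Z (U - {w}) = x u * ?Z (U - {w} - {u}) + (\<Sum>e\<in>?S (U - {w}). t * ?Z (U - {w} - e))"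
    using vertex[of "U - {w}"] less.prems by auto
  have sub: "?S (U - {w}) = {e \<in> ?S U. w \<notin> e}" by auto
  have "(\<Sum>e\<in>?S (U - {w}). t * ?Z (U - {w} - e))
    = (\<Sum>e\<in>?S U. if w \<notin> e then t * ?Z (U - {w} - e) else 0)"
    unfolding sub using fin[of U] by (simp only: sum.inter_filter)
  moreover have "U - {w} - {u} = U - {u, w}" by auto
  \<comment> \<open>The two terms with factor \<open>x u\<close> cancel, leaving a sum over the
    edges at \<open>u\<close> whose summands can be signed one by one.\<close>
  ultimately have diff: "?Z U * ?Z (U - {u, w}) - ?Z (U - {u}) * ?Z (U - {w})
    = (\<Sum>e\<in>?S U. t * ?Z (U - e) * ?Z (U - {u, w})
        - ?Z (U - {u}) * (if w \<notin> e then t * ?Z (U - {w} - e) else 0))"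
    unfolding ZU Zw by (simp add: algebra_simps sum_subtractf sum_distrib_left)
  have pos: "?Z W \<ge> 0" if "W \<subseteq> U" for W
    using monomer_dimer_pos[OF assms(1) _ ne assms(3), of W x] that less.prems
    by (meson finite_subset less_imp_le subsetD)
  have small: "card (U - {u}) < card U" using less.prems by (meson card_Diff1_less)
  have nbr: "\<exists>v. e = {u, v} \<and> v \<noteq> u \<and> v \<in> U \<and> (v \<in> A) = (u \<notin> A)" if "e \<in> ?S U" for e
    using that bip[of e] assms(2) by blast
  have sets: "U - {u} - {w, v} = U - {w} - {u, v}" "U - {u} - {v} = U - {u, v}"
    "U - {u} - {w} = U - {u, w}" for v by auto
  \<comment> \<open>The induction hypothesis for the pair \<open>w\<close>, \<open>v\<close> in
    \<open>U - {u}\<close>, where \<open>v\<close> will be a neighbour of \<open>u\<close>.\<close>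
  have IH: "if (w \<in> A) = (v \<in> A)
    then ?Z (U - {u}) * ?Z (U - {w} - {u, v}) \<le> ?Z (U - {u, w}) * ?Z (U - {u, v})
    else ?Z (U - {u}) * ?Z (U - {w} - {u, v}) \<ge> ?Z (U - {u, w}) * ?Z (U - {u, v})"
    if "v \<in> U" "v \<noteq> u" "v \<noteq> w" for v
  proof -
    have "finite (U - {u})" "\<And>v. v \<in> U - {u} \<Longrightarrow> x v > 0" "U - {u} \<subseteq> A \<union> B"
      "w \<in> U - {u}" "v \<in> U - {u}" "w \<noteq> v"
      using less.prems that by auto
    from less.hyps[OF small this] show ?thesis unfolding sets .
  qed
  show ?case
  proof (cases "(u \<in> A) = (w \<in> A)")
    case True
    have "(\<Sum>e\<in>?S U. t * ?Z (U - e) * ?Z (U - {u, w})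
        - ?Z (U - {u}) * (if w \<notin> e then t * ?Z (U - {w} - e) else 0)) \<le> 0"
    proof (rule sum_nonpos)
      fix e assume "e \<in> ?S U"
      then obtain v where v: "e = {u, v}" "v \<noteq> u" "v \<in> U" "(v \<in> A) = (u \<notin> A)"
        using nbr by blast
      then have "v \<noteq> w" using True by auto
      then have "?Z (U - {u}) * ?Z (U - {w} - {u, v}) \<ge> ?Z (U - {u, w}) * ?Z (U - {u, v})"
        using IH[of v] v True by auto
      then have "t * (?Z (U - {u}) * ?Z (U - {w} - {u, v})) \<ge> t * (?Z (U - {u, w}) * ?Z (U - {u, v}))"
        using assms(3) by (intro mult_left_mono) auto
      then show "t * ?Z (U - e) * ?Z (U - {u, w})
        - ?Z (U - {u}) * (if w \<notin> e then t * ?Z (U - {w} - e) else 0) \<le> 0"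
        using v \<open>v \<noteq> w\<close> less.prems by (simp add: algebra_simps)
    qed
    then show ?thesis using diff True by simp
  next
    case False
    have "(\<Sum>e\<in>?S U. t * ?Z (U - e) * ?Z (U - {u, w})
        - ?Z (U - {u}) * (if w \<notin> e then t * ?Z (U - {w} - e) else 0)) \<ge> 0"
    proof (rule sum_nonneg)
      fix e assume "e \<in> ?S U"
      then obtain v where v: "e = {u, v}" "v \<noteq> u" "v \<in> U" "(v \<in> A) = (u \<notin> A)"
        using nbr by blast
      show "t * ?Z (U - e) * ?Z (U - {u, w})
        - ?Z (U - {u}) * (if w \<notin> e then t * ?Z (U - {w} - e) else 0) \<ge> 0"
      proof (cases "v = w")
        \<comment> \<open>For the edge \<open>{u, w}\<close> itself the subtracted product is
          absent, and what remains is nonnegative.\<close>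
        case True
        then show ?thesis using v pos[of "U - e"] pos[of "U - {u, w}"] assms(3) by simp
      next
        case nw: False
        then have "?Z (U - {u}) * ?Z (U - {w} - {u, v}) \<le> ?Z (U - {u, w}) * ?Z (U - {u, v})"
          using IH[of v] v False by auto
        then have "t * (?Z (U - {u}) * ?Z (U - {w} - {u, v})) \<le> t * (?Z (U - {u, w}) * ?Z (U - {u, v}))"
          using assms(3) by (intro mult_left_mono) auto
        then show ?thesis
          using v nw less.prems by (simp add: algebra_simps)
      qed
    qed
    then show ?thesis using diff False by simp
  qed
qed

section \<open>The edge-by-edge lower bound\<close>

text \<open>With \<open>s = 1 - d * \<alpha> > 0\<close>, this is the infimum of \<open>(x + y\<^sub>1 + \<dots> + y\<^sub>d) / (y\<^sub>1 \<cdots> y\<^sub>d) powr \<alpha>\<close>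
  over positive \<open>y\<^sub>i\<close>.\<close>
definition bethe_factor :: "real \<Rightarrow> nat \<Rightarrow> real \<Rightarrow> real" where
  "bethe_factor \<alpha> d x = (let s = 1 - real d * \<alpha> in (x / s) powr s / \<alpha> powr (real d * \<alpha>))"

lemma bethe_factor_pos:
  assumes "0 < \<alpha>" "real d * \<alpha> < 1" "0 < x"
  shows "bethe_factor \<alpha> d x > 0"
  using assms by (simp add: bethe_factor_def Let_def)

text \<open>In the infimum for \<open>Suc d\<close>, fixing one variable at \<open>y\<close> can
  only increase the value, and the remaining infimum is the one for \<open>d\<close> at weight
  \<open>x + y\<close>. The proof does this directly, by a single weighted AM-GM inequality.\<close>

lemma bethe_factor_Suc_le:
  assumes \<alpha>: "0 < \<alpha>" and d: "real (Suc d) * \<alpha> < 1" and x: "0 < x" and y: "0 < y"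
  shows "y powr \<alpha> * bethe_factor \<alpha> (Suc d) x \<le> bethe_factor \<alpha> d (x + y)"
proof -
  define s where "s = 1 - real d * \<alpha>"
  have s: "0 < s" "0 < s - \<alpha>" using assms by (auto simp: s_def algebra_simps)
  \<comment> \<open>The weights \<open>(s - \<alpha>) / s\<close> and \<open>\<alpha> / s\<close>
    make the arithmetic mean equal to \<open>(x + y) / s\<close>.\<close>
  have "((x / (s - \<alpha>)) powr ((s - \<alpha>) / s)) * ((y / \<alpha>) powr (\<alpha> / s))
    \<le> (s - \<alpha>) / s * (x / (s - \<alpha>)) + \<alpha> / s * (y / \<alpha>)"
    using assms s by (intro Youngs_inequality_0) (auto simp: field_simps)
  also have "\<dots> = (x + y) / s" using s \<alpha> by (simp add: field_simps)
  finally have "(((x / (s - \<alpha>)) powr ((s - \<alpha>) / s)) * ((y / \<alpha>) powr (\<alpha> / s))) powr s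
    \<le> ((x + y) / s) powr s"
    using s by (intro powr_mono2) auto
  then have "(x / (s - \<alpha>)) powr (s - \<alpha>) * (y / \<alpha>) powr \<alpha> \<le> ((x + y) / s) powr s"
    using s assms by (simp add: powr_mult powr_powr)
  then have le: "(x / (s - \<alpha>)) powr (s - \<alpha>) * (y / \<alpha>) powr \<alpha> / \<alpha> powr (real d * \<alpha>)
    \<le> ((x + y) / s) powr s / \<alpha> powr (real d * \<alpha>)"
    using \<alpha> by (intro divide_right_mono) auto
  have "1 - real (Suc d) * \<alpha> = s - \<alpha>" by (simp add: s_def algebra_simps)
  moreover have "\<alpha> powr (real (Suc d) * \<alpha>) = \<alpha> powr \<alpha> * \<alpha> powr (real d * \<alpha>)"
    by (simp add: powr_add[symmetric] algebra_simps)
  ultimately have "y powr \<alpha> * bethe_factor \<alpha> (Suc d) x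
    = (x / (s - \<alpha>)) powr (s - \<alpha>) * (y / \<alpha>) powr \<alpha> / \<alpha> powr (real d * \<alpha>)"
    unfolding bethe_factor_def Let_def using \<alpha> y by (simp only: powr_divide) (simp add: mult_ac)
  with le show ?thesis
    unfolding bethe_factor_def Let_def s_def[symmetric] by simp
qed

text \<open>The witnesses balance the two mixed terms, \<open>y * b = z * c\<close>, which bounds the polynomial by the
  square of \<open>sqrt a + s * sqrt d\<close> with \<open>s\<^sup>2 = y * z\<close>; the value of \<open>s\<close> then minimises the quotient by
  \<open>s powr (2 * \<alpha>)\<close>.\<close>
lemma edge_gluing:
  fixes \<alpha> t a b c d :: real
  assumes \<alpha>: "0 < \<alpha>" "\<alpha> < 1" and pos: "0 < t" "0 < a" "0 < b" "0 < c" "0 < d"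
    and corr: "b * c \<le> a * d"
  obtains y z where "0 < y" "0 < z"
    "t powr \<alpha> * \<alpha> powr \<alpha> * (1 - \<alpha>) powr (1 - \<alpha>) * (a + y * b + z * c + y * z * d)
      \<le> (a + t * d) * (y powr \<alpha> * z powr \<alpha>)"
proof -
  define s where "s = \<alpha> * sqrt a / ((1 - \<alpha>) * sqrt d)"
  define y where "y = s * sqrt (c / b)"
  define z where "z = s * sqrt (b / c)"
  have s: "s > 0" using assms by (simp add: s_def)
  have y: "y > 0" and z: "z > 0" using s pos by (auto simp: y_def z_def)
  have "sqrt (c / b) * sqrt (b / c) = 1"
    using pos by (simp add: real_sqrt_mult[symmetric])
  then have yz: "y * z = s\<^sup>2" by (simp add: y_def z_def power2_eq_square algebra_simps)
  have sq: "sqrt (c / b) * b = sqrt (b * c)" "sqrt (b / c) * c = sqrt (b * c)"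
    using pos by (auto simp: real_sqrt_divide real_sqrt_mult field_simps)
  have "sqrt (b * c) \<le> sqrt (a * d)" using corr by simp
  then have "s * sqrt (b * c) \<le> s * (sqrt a * sqrt d)" using s by (simp add: real_sqrt_mult)
  moreover have "y * b = s * sqrt (b * c)" "z * c = s * sqrt (b * c)"
    using sq by (auto simp: y_def z_def mult.assoc)
  ultimately have "a + y * b + z * c + y * z * d \<le> a + 2 * (s * (sqrt a * sqrt d)) + s\<^sup>2 * d"
    by (simp add: yz)
  also have "\<dots> = (sqrt a + s * sqrt d)\<^sup>2"
    using pos by (simp add: power2_sum power_mult_distrib algebra_simps)
  also have "sqrt a + s * sqrt d = sqrt a / (1 - \<alpha>)"
    using pos \<alpha> by (simp add: s_def field_simps)
  also have "(sqrt a / (1 - \<alpha>))\<^sup>2 = a / (1 - \<alpha>)\<^sup>2"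
    using pos by (simp add: power_divide)
  finally have P: "a + y * b + z * c + y * z * d \<le> a / (1 - \<alpha>)\<^sup>2" .
  have "s\<^sup>2 = (\<alpha>\<^sup>2 * a) / ((1 - \<alpha>)\<^sup>2 * d)"
    using pos by (simp add: s_def power_divide power_mult_distrib)
  then have yza: "y powr \<alpha> * z powr \<alpha> = ((\<alpha>\<^sup>2 * a) / ((1 - \<alpha>)\<^sup>2 * d)) powr \<alpha>"
    using y z yz by (simp add: powr_mult[symmetric])
  \<comment> \<open>For the chosen \<open>s\<close> this is an equality, checked on logarithms. The
    only losses are in \<open>P\<close>, through the correlation, and in \<open>R\<close>, through
    AM-GM.\<close>
  have Q: "t powr \<alpha> * \<alpha> powr \<alpha> * (1 - \<alpha>) powr (1 - \<alpha>) * (a / (1 - \<alpha>)\<^sup>2)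
    = ((a / (1 - \<alpha>)) powr (1 - \<alpha>) * (t * d / \<alpha>) powr \<alpha>) * (y powr \<alpha> * z powr \<alpha>)"
  proof -
    have "ln (t powr \<alpha> * \<alpha> powr \<alpha> * (1 - \<alpha>) powr (1 - \<alpha>) * (a / (1 - \<alpha>)\<^sup>2))
      = ln (((a / (1 - \<alpha>)) powr (1 - \<alpha>) * (t * d / \<alpha>) powr \<alpha>) * (y powr \<alpha> * z powr \<alpha>))"
      unfolding yza using pos \<alpha>
      by (simp add: ln_mult ln_div ln_powr ln_realpow) (simp add: algebra_simps)
    then show ?thesis
      using pos \<alpha> y z by (subst (asm) ln_inj_iff) auto
  qed
  have "(a / (1 - \<alpha>)) powr (1 - \<alpha>) * (t * d / \<alpha>) powr \<alpha>
    \<le> (1 - \<alpha>) * (a / (1 - \<alpha>)) + \<alpha> * (t * d / \<alpha>)"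
    using pos \<alpha> by (intro Youngs_inequality_0) auto
  also have "\<dots> = a + t * d" using \<alpha> by simp
  finally have R: "(a / (1 - \<alpha>)) powr (1 - \<alpha>) * (t * d / \<alpha>) powr \<alpha> \<le> a + t * d" .
  have "t powr \<alpha> * \<alpha> powr \<alpha> * (1 - \<alpha>) powr (1 - \<alpha>) * (a + y * b + z * c + y * z * d)
    \<le> t powr \<alpha> * \<alpha> powr \<alpha> * (1 - \<alpha>) powr (1 - \<alpha>) * (a / (1 - \<alpha>)\<^sup>2)"
    using P by (intro mult_left_mono) auto
  also have "\<dots> \<le> (a + t * d) * (y powr \<alpha> * z powr \<alpha>)"
    unfolding Q using R by (intro mult_right_mono) auto
  finally show thesis using that y z by blast
qed

lemma degree_insert:
  assumes "finite F" "e \<notin> F"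
  shows "degree (insert e F) v = degree F v + (if v \<in> e then 1 else 0)"
proof -
  have "{f \<in> insert e F. v \<in> f} = (if v \<in> e then insert e {f \<in> F. v \<in> f} else {f \<in> F. v \<in> f})"
    by auto
  then show ?thesis using assms by (simp add: degree_def)
qed

text \<open>Each edge costs one factor from \<open>edge_gluing\<close>, and
  \<open>bethe_factor_Suc_le\<close> absorbs its two half-edges into the vertex factors. The weights
  stay arbitrary in the induction, since the hypothesis is applied to the graph without
  \<open>e\<close> at weights raised in \<open>u\<close> and \<open>w\<close>.\<close>

lemma monomer_dimer_ge_bethe:
  assumes "finite F" "A \<inter> B = {}" "t > 0" "finite A" "finite B"
    and "\<And>e. e \<in> F \<Longrightarrow> \<exists>x\<in>A. \<exists>y\<in>B. e = {x, y}"
    and \<alpha>: "0 < \<alpha>" "\<alpha> < 1" and "\<And>v. v \<in> A \<union> B \<Longrightarrow> real (degree F v) * \<alpha> < 1"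
    and "\<And>v. v \<in> A \<union> B \<Longrightarrow> x v > 0"
  shows "(t powr \<alpha> * \<alpha> powr \<alpha> * (1 - \<alpha>) powr (1 - \<alpha>)) ^ card F
      * (\<Prod>v\<in>A \<union> B. bethe_factor \<alpha> (degree F v) (x v))
    \<le> monomer_dimer x t F (A \<union> B)"
  using assms(1,6,9,10)
proof (induction F arbitrary: x rule: finite_induct)
  case empty
  have "bethe_factor \<alpha> (degree {} v) (x v) = x v" if "v \<in> A \<union> B" for v
    using empty(3)[OF that] \<alpha> by (simp add: bethe_factor_def degree_def)
  then show ?case by (simp add: monomer_dimer_empty)
next
  case (insert e F)
  let ?V = "A \<union> B" and ?c = "t powr \<alpha> * \<alpha> powr \<alpha> * (1 - \<alpha>) powr (1 - \<alpha>)"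
  let ?Z = "\<lambda>x. monomer_dimer x t F"
  obtain u w where uw: "u \<in> A" "w \<in> B" "e = {u, w}" using insert.prems(1) by blast
  have "u \<noteq> w" using uw assms(2) by blast
  have bip: "\<And>e. e \<in> F \<Longrightarrow> \<exists>x\<in>A. \<exists>y\<in>B. e = {x, y}" using insert.prems(1) by blast
  have ne: "{} \<notin> F" using bip by blast
  have finV: "finite ?V" using assms(4,5) by simp
  have deg: "real (degree F v) * \<alpha> < 1" if "v \<in> ?V" for v
  proof -
    have "real (degree F v) * \<alpha> \<le> real (degree (insert e F) v) * \<alpha>"
      using \<alpha> insert.hyps by (intro mult_right_mono) (auto simp: degree_insert)
    then show ?thesis using insert.prems(2)[OF that] by linarith
  qed
  have pos: "?Z x U > 0" if "U \<subseteq> ?V" for U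
    by (rule monomer_dimer_pos[OF insert.hyps(1) _ ne assms(3)])
      (use that finV finite_subset insert.prems(3) in auto)
  have uA: "w \<notin> A" using uw assms(2) by blast
  \<comment> \<open>The endpoints of \<open>e\<close> lie on opposite sides, which selects the
    positive correlation.\<close>
  have corr: "?Z x (?V - {u}) * ?Z x (?V - {w}) \<le> ?Z x ?V * ?Z x (?V - {u, w})"
    using monomer_dimer_correlation[OF insert.hyps(1) assms(2,3) bip finV insert.prems(3), where u = u and w = w]
      uw \<open>u \<noteq> w\<close> uA by simp
  obtain y z where yz: "0 < y" "0 < z"
    and glue: "?c * (?Z x ?V + y * ?Z x (?V - {u}) + z * ?Z x (?V - {w}) + y * z * ?Z x (?V - {u, w}))
      \<le> (?Z x ?V + t * ?Z x (?V - {u, w})) * (y powr \<alpha> * z powr \<alpha>)"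
    by (rule edge_gluing[OF \<alpha> assms(3) pos pos pos pos corr]) auto
  define x' where "x' = (x(u := x u + y))(w := x w + z)"
  have x'_eq: "x' u = x u + y" "x' w = x w + z" "v \<noteq> u \<Longrightarrow> v \<noteq> w \<Longrightarrow> x' v = x v" for v
    using \<open>u \<noteq> w\<close> by (auto simp: x'_def)
  have "?Z x' ?V = ?Z (x(u := x u + y)) ?V + z * ?Z (x(u := x u + y)) (?V - {w})"
    using monomer_dimer_upd_add[OF insert.hyps(1) finV ne, of w "x(u := x u + y)" z t] uw \<open>u \<noteq> w\<close>
    by (simp add: x'_def)
  also have "?Z (x(u := x u + y)) ?V = ?Z x ?V + y * ?Z x (?V - {u})"
    using monomer_dimer_upd_add[OF insert.hyps(1) finV ne, of u] uw by simp
  also have "?Z (x(u := x u + y)) (?V - {w}) = ?Z x (?V - {w}) + y * ?Z x (?V - {w} - {u})"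
    by (rule monomer_dimer_upd_add[OF insert.hyps(1) _ ne]) (use finV uw \<open>u \<noteq> w\<close> in auto)
  also have "?V - {w} - {u} = ?V - {u, w}" by auto
  finally have Zx': "?Z x' ?V
    = ?Z x ?V + y * ?Z x (?V - {u}) + z * ?Z x (?V - {w}) + y * z * ?Z x (?V - {u, w})"
    by (simp add: algebra_simps)
  have x'pos: "x' v > 0" if "v \<in> ?V" for v
    using insert.prems(3)[OF that] yz by (auto simp: x'_def add_pos_pos)
  have IH: "?c ^ card F * (\<Prod>v\<in>?V. bethe_factor \<alpha> (degree F v) (x' v)) \<le> ?Z x' ?V"
    using insert.IH[of x'] bip deg x'pos by blast
  \<comment> \<open>\<open>h\<close> collects the half-edge factors split off at \<open>u\<close>
    and \<open>w\<close>, so that the vertex estimates can be multiplied over all of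
    \<open>?V\<close>.\<close>
  define h where "h v = (if v = u then y powr \<alpha> else if v = w then z powr \<alpha> else 1)" for v
  have "(\<Prod>v\<in>?V. h v) = (\<Prod>v\<in>{u, w}. h v)"
    using finV uw by (intro prod.mono_neutral_right) (auto simp: h_def)
  then have h: "(\<Prod>v\<in>?V. h v) = y powr \<alpha> * z powr \<alpha>" using \<open>u \<noteq> w\<close> by (simp add: h_def)
  let ?D = "degree (insert e F)"
  have fac: "h v * bethe_factor \<alpha> (?D v) (x v) \<le> bethe_factor \<alpha> (degree F v) (x' v)"
    if "v \<in> ?V" for v
  proof (cases "v \<in> e")
    case True
    then have D: "?D v = Suc (degree F v)" using insert.hyps by (simp add: degree_insert)
    have "h v * bethe_factor \<alpha> (Suc (degree F v)) (x v)
        \<le> bethe_factor \<alpha> (degree F v) (x v + (if v = u then y else z))"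
      using bethe_factor_Suc_le[OF \<alpha>(1) _ insert.prems(3)[OF that], of "degree F v"]
        insert.prems(2)[OF that] yz True uw(3) unfolding D h_def by auto
    then show ?thesis using True uw(3) x'_eq \<open>u \<noteq> w\<close> D by (auto split: if_splits)
  next
    case False
    then show ?thesis using x'_eq(3)[of v] uw(3) insert.hyps by (simp add: degree_insert h_def)
  qed
  have "(\<Prod>v\<in>?V. h v * bethe_factor \<alpha> (?D v) (x v)) \<le> (\<Prod>v\<in>?V. bethe_factor \<alpha> (degree F v) (x' v))"
    using fac bethe_factor_pos[OF \<alpha>(1) insert.prems(2) insert.prems(3)]
    by (intro prod_mono) (auto simp: h_def less_imp_le)
  then have "?c * (?c ^ card F * (y powr \<alpha> * z powr \<alpha> * (\<Prod>v\<in>?V. bethe_factor \<alpha> (?D v) (x v))))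
    \<le> ?c * (?c ^ card F * (\<Prod>v\<in>?V. bethe_factor \<alpha> (degree F v) (x' v)))"
    unfolding prod.distrib h by (intro mult_left_mono) auto
  also have "\<dots> \<le> ?c * ?Z x' ?V" using IH by (intro mult_left_mono) auto
  also have "\<dots> \<le> (?Z x ?V + t * ?Z x (?V - {u, w})) * (y powr \<alpha> * z powr \<alpha>)"
    using glue Zx' by simp
  also have "?Z x ?V + t * ?Z x (?V - {u, w}) = monomer_dimer x t (insert e F) ?V"
    using insert.hyps uw by (simp add: monomer_dimer_insert)
  \<comment> \<open>The factor \<open>y powr \<alpha> * z powr \<alpha>\<close> stands on both sides
    and cancels, so the bound no longer depends on the witnesses.\<close>
  finally have "(?c ^ card (insert e F) * (\<Prod>v\<in>?V. bethe_factor \<alpha> (?D v) (x v))) * (y powr \<alpha> * z powr \<alpha>)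
    \<le> monomer_dimer x t (insert e F) ?V * (y powr \<alpha> * z powr \<alpha>)"
    using insert.hyps by (simp add: mult_ac)
  moreover have "0 < y powr \<alpha> * z powr \<alpha>" using yz by simp
  ultimately show ?case using mult_right_le_imp_le by blast
qed

section \<open>Matching polynomials of biregular graphs\<close>

lemma num_matchings_0: "finite E \<Longrightarrow> num_matchings E 0 = 1"
proof -
  assume "finite E"
  then have "{M. matching E M \<and> card M = 0} = {{}}"
    by (auto simp: matching_def dest: finite_subset)
  then show ?thesis by (simp add: num_matchings_def)
qed

lemma matching_card_le:
  assumes "finite E" "matching E M"
  shows "card M \<le> card E"
proof -
  have "M \<subseteq> E" using assms(2) unfolding matching_def by (rule conjunct1)
  then show ?thesis using assms(1) by (rule card_mono[rotated])
qed

lemma finite_matching_cards: "finite E \<Longrightarrow> finite {card M | M. matching E M}"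
proof -
  assume "finite E"
  then have "finite {M. matching E M}"
    using finite_matchings[of E "\<lambda>_. True"] by simp
  moreover have "{card M | M. matching E M} = card ` {M. matching E M}"
    unfolding image_def by blast
  ultimately show ?thesis by (metis finite_imageI)
qed

lemma max_matching_attained:
  assumes "finite E"
  obtains M where "matching E M" "card M = max_matching E"
proof -
  have "matching E {}" by (simp add: matching_def)
  then have "{card M | M. matching E M} \<noteq> {}" by blast
  then have "max_matching E \<in> {card M | M. matching E M}"
    unfolding max_matching_def by (rule Max_in[OF finite_matching_cards[OF assms]])
  then show thesis using that by auto
qed

lemma num_matchings_max_pos:
  assumes "finite E"
  shows "num_matchings E (max_matching E) > 0"
proof -
  obtain M where "matching E M" "card M = max_matching E"
    by (rule max_matching_attained[OF assms])
  moreover have "finite {M. matching E M \<and> card M = max_matching E}"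
    by (rule finite_matchings[OF assms])
  ultimately show ?thesis unfolding num_matchings_def card_gt_0_iff by blast
qed

lemma num_matchings_eq_0:
  assumes "finite E" "k > max_matching E"
  shows "num_matchings E k = 0"
proof -
  have "card M \<le> max_matching E" if "matching E M" for M
    unfolding max_matching_def using that
    by (intro Max_ge[OF finite_matching_cards[OF assms(1)]]) auto
  then have "{M. matching E M \<and> card M = k} = {}" using assms(2) by force
  then show ?thesis unfolding num_matchings_def by (simp only: card.empty)
qed

lemma match_poly_eq_monomer_dimer:
  assumes "finite E" "\<Union>E \<subseteq> V"
  shows "match_poly E t = monomer_dimer (\<lambda>_. 1) t E V"
proof -
  let ?S = "{M. matching E M}"
  have fin: "finite ?S" using finite_matchings[OF assms(1), of "\<lambda>_. True"] by simp
  have "match_poly E t = (\<Sum>k\<le>card E. \<Sum>M\<in>{M \<in> ?S. card M = k}. t ^ card M)"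
    by (simp add: match_poly_def num_matchings_def)
  also have "\<dots> = (\<Sum>M\<in>?S. t ^ card M)"
    by (rule sum.group[OF fin]) (auto intro: matching_card_le[OF assms(1)])
  also have "?S = {M. matching E M \<and> \<Union>M \<subseteq> V}"
    using assms(2) by (auto simp: matching_def)
  finally show ?thesis by (simp add: monomer_dimer_def)
qed

lemma match_poly_ge_1:
  assumes "finite E" "t \<ge> 0"
  shows "match_poly E t \<ge> 1"
proof -
  have "real (num_matchings E 0) * t ^ 0 \<le> match_poly E t"
    unfolding match_poly_def using assms(2) by (intro member_le_sum) auto
  then show ?thesis by (simp add: num_matchings_0[OF assms(1)])
qed

text \<open>For \<open>t \<ge> 1\<close> the largest power present dominates every other one. This
  upper bound on the growth is later played against the lower bound.\<close>

lemma match_poly_le_power: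
  assumes "finite E" "t \<ge> 1"
  shows "match_poly E t \<le> match_poly E 1 * t ^ max_matching E"
  unfolding match_poly_def sum_distrib_right
proof (rule sum_mono)
  fix k
  show "real (num_matchings E k) * t ^ k \<le> real (num_matchings E k) * 1 ^ k * t ^ max_matching E"
  proof (cases "k \<le> max_matching E")
    case True
    then show ?thesis using assms(2) by (simp add: mult_left_mono power_increasing)
  next
    case False
    then show ?thesis using num_matchings_eq_0[OF assms(1), of k] by simp
  qed
qed

section \<open>Edge counts and the logarithmic bound in biregular graphs\<close>

text \<open>Double counting of incidences: every edge has exactly one endpoint on each side.\<close>

lemma biregular_card_edges:
  assumes "biregular_bipartite V E A B a b"
  shows "finite E" "finite A" "finite B" "card E = a * card A" "card E = b * card B"
proof -
  have V: "finite V" "A \<union> B = V" "E \<subseteq> Pow V" and disj: "A \<inter> B = {}"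
    and bip: "\<forall>e\<in>E. \<exists>x\<in>A. \<exists>y\<in>B. e = {x, y}"
    using assms by (auto simp: biregular_bipartite_def simple_graph_def)
  show fin: "finite E" "finite A" "finite B"
    using V finite_subset[of E "Pow V"] finite_subset[of A V] finite_subset[of B V] by auto
  have "\<forall>v\<in>A. card {e \<in> E. v \<in> e} = a" "\<forall>v\<in>B. card {e \<in> E. v \<in> e} = b"
    using assms unfolding biregular_bipartite_def degree_def by simp_all
  from sum_multicount[OF fin(1,2) this(1)] sum_multicount[OF fin(1,3) this(2)]
  have AB: "(\<Sum>e\<in>E. card {v\<in>A. v \<in> e}) = a * card A" "(\<Sum>e\<in>E. card {v\<in>B. v \<in> e}) = b * card B" .
  have one: "card {v\<in>A. v \<in> e} = 1" "card {v\<in>B. v \<in> e} = 1" if e: "e \<in> E" for e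
  proof -
    obtain x y where xy: "x \<in> A" "y \<in> B" "e = {x, y}"
      using bip e by blast
    have "y \<notin> A" "x \<notin> B" using xy(1,2) disj by blast+
    then have "{v\<in>A. v \<in> e} = {x}" "{v\<in>B. v \<in> e} = {y}"
      using xy by blast+
    then show "card {v\<in>A. v \<in> e} = 1" "card {v\<in>B. v \<in> e} = 1" by simp_all
  qed
  show "card E = a * card A" unfolding AB(1)[symmetric] by (simp only: one(1) cong: sum.cong) simp
  show "card E = b * card B" unfolding AB(2)[symmetric] by (simp only: one(2) cong: sum.cong) simp
qed

text \<open>The edge-by-edge bound with all weights 1 and degrees \<open>a\<close> and
  \<open>b\<close>, in logarithmic form. The bounds on \<open>p\<close> say exactly that
  \<open>a * \<alpha>\<close> and \<open>b * \<alpha>\<close> are below 1; this range extends beyond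
  that of the theorem, which gives \<open>max_matching_gt\<close> room to raise the
  parameter.\<close>

lemma ln_match_poly_ge:
  fixes p t :: real
  assumes "0 < a" "0 < b" and graph: "biregular_bipartite V E A B a b"
    and "0 < p" "p * real (a + b) < 2 * real a" "p * real (a + b) < 2 * real b" "0 < t"
  shows "ln (match_poly E t) \<ge> real (card V) * (G_ab a b p + p / 2 * ln t)"
proof -
  note fin = biregular_card_edges(1,2,3)[OF graph]
  have V: "V = A \<union> B" "A \<inter> B = {}"
    and bip: "\<And>e. e \<in> E \<Longrightarrow> \<exists>x\<in>A. \<exists>y\<in>B. e = {x, y}"
    and deg: "\<And>v. v \<in> A \<Longrightarrow> degree E v = a" "\<And>v. v \<in> B \<Longrightarrow> degree E v = b"
    using graph by (auto simp: biregular_bipartite_def)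
  define \<alpha> where "\<alpha> = p * real (a + b) / (2 * real a * real b)"
  \<comment> \<open>A matching with \<open>m * \<alpha>\<close> edges covers the fraction
    \<open>b * \<alpha>\<close> of \<open>B\<close> and \<open>a * \<alpha>\<close> of
    \<open>A\<close>; these are the arguments of the first two entropies.\<close>
  have args: "real (a + b) / (2 * real a) * p = real b * \<alpha>"
    "real (a + b) / (2 * real b) * p = real a * \<alpha>"
    "real (a + b) / (2 * real a * real b) * p = \<alpha>"
    using assms(1,2) by (simp_all add: \<alpha>_def)
  have \<alpha>0: "\<alpha> > 0" using assms by (simp add: \<alpha>_def)
  have \<alpha>a: "real a * \<alpha> < 1" and \<alpha>b: "real b * \<alpha> < 1"
    using assms unfolding args[symmetric] by (simp_all add: pos_divide_less_eq mult.commute)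
  have "1 * \<alpha> \<le> real a * \<alpha>" using assms(1) \<alpha>0 by (intro mult_right_mono) auto
  then have \<alpha>1: "\<alpha> < 1" using \<alpha>a by simp
  define m where "m = real (card E)"
  define nA where "nA = real (card A)"
  define nB where "nB = real (card B)"
  have mA: "m = real a * nA" and mB: "m = real b * nB"
    unfolding m_def nA_def nB_def using biregular_card_edges(4,5)[OF graph] of_nat_mult by metis+
  have v: "real (card V) = nA + nB"
    using V fin by (simp add: card_Un_disjoint nA_def nB_def)
  let ?c = "t powr \<alpha> * \<alpha> powr \<alpha> * (1 - \<alpha>) powr (1 - \<alpha>)"
  have "?c ^ card E * (\<Prod>v\<in>A \<union> B. bethe_factor \<alpha> (degree E v) 1)
    \<le> monomer_dimer (\<lambda>_. 1) t E (A \<union> B)"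
    by (rule monomer_dimer_ge_bethe) (use fin V bip deg \<alpha>0 \<alpha>1 \<alpha>a \<alpha>b assms in auto)
  moreover have "match_poly E t = monomer_dimer (\<lambda>_. 1) t E (A \<union> B)"
    by (rule match_poly_eq_monomer_dimer[OF fin(1)]) (use bip in fastforce)
  moreover have "(\<Prod>v\<in>A \<union> B. bethe_factor \<alpha> (degree E v) 1)
    = bethe_factor \<alpha> a 1 ^ card A * bethe_factor \<alpha> b 1 ^ card B"
    using fin V deg by (simp add: prod.union_disjoint)
  ultimately have M: "?c ^ card E * (bethe_factor \<alpha> a 1 ^ card A * bethe_factor \<alpha> b 1 ^ card B)
    \<le> match_poly E t" by simp
  have bf_pos: "bethe_factor \<alpha> a 1 > 0" "bethe_factor \<alpha> b 1 > 0"
    using \<alpha>0 \<alpha>a \<alpha>b by (auto intro: bethe_factor_pos)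
  have c_pos: "?c > 0" using \<alpha>0 \<alpha>1 assms by simp
  have ln_bf: "ln (bethe_factor \<alpha> d 1)
      = - ((1 - real d * \<alpha>) * ln (1 - real d * \<alpha>)) - real d * \<alpha> * ln \<alpha>"
    if "real d * \<alpha> < 1" for d
    using that \<alpha>0 by (simp add: bethe_factor_def Let_def ln_div ln_powr)
  have ln_prod: "ln (x ^ i * (y ^ j * z ^ k)) = real i * ln x + (real j * ln y + real k * ln z)"
    if "0 < x" "0 < y" "0 < z" for x y z :: real and i j k
    using that by (simp add: ln_mult ln_realpow)
  have "ln (?c ^ card E * (bethe_factor \<alpha> a 1 ^ card A * bethe_factor \<alpha> b 1 ^ card B))
    = m * ln ?c + (nA * ln (bethe_factor \<alpha> a 1) + nB * ln (bethe_factor \<alpha> b 1))"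
    unfolding m_def nA_def nB_def by (rule ln_prod[OF c_pos bf_pos])
  moreover have "0 < ?c ^ card E * (bethe_factor \<alpha> a 1 ^ card A * bethe_factor \<alpha> b 1 ^ card B)"
    using c_pos bf_pos by (simp only: zero_less_power mult_pos_pos)
  ultimately have lnM: "m * ln ?c + (nA * ln (bethe_factor \<alpha> a 1) + nB * ln (bethe_factor \<alpha> b 1))
    \<le> ln (match_poly E t)"
    using M by (metis ln_mono)
  have ln_c: "ln ?c = \<alpha> * ln t + \<alpha> * ln \<alpha> + (1 - \<alpha>) * ln (1 - \<alpha>)"
    using \<alpha>0 \<alpha>1 assms by (simp add: ln_mult ln_powr)
  have H: "H_ent q = - (q * ln q) - (1 - q) * ln (1 - q)" if "0 < q" "q < 1" for q
    using that by (simp add: H_ent_def)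
  \<comment> \<open>Since \<open>a * nA = b * nB\<close>, the coefficients in \<open>G_ab\<close>
    are the share of \<open>B\<close>, the share of \<open>A\<close> and the number of edges per
    vertex.\<close>
  have w: "(nA + nB) * (real a / real (a + b)) = nB" "(nA + nB) * (real b / real (a + b)) = nA"
    "(nA + nB) * (real a * real b / real (a + b)) = m"
    using mA mB assms(1,2) by (simp_all add: field_simps)
  have wp: "(nA + nB) * (1 / 2 * p) = m * \<alpha>"
  proof -
    have "1 / 2 * p = real a * real b / real (a + b) * \<alpha>"
      using assms(1,2) by (simp add: \<alpha>_def)
    then show ?thesis using w(3) by (metis mult.assoc)
  qed
  have "(nA + nB) * (G_ab a b p + 1 / 2 * p * ln t)
    = (nA + nB) * (real a / real (a + b)) * H_ent (real b * \<alpha>)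
    + (nA + nB) * (real b / real (a + b)) * H_ent (real a * \<alpha>)
    + (nA + nB) * (1 / 2 * p) * (ln (real a * real b) + ln t)
    - (nA + nB) * (real a * real b / real (a + b)) * H_ent \<alpha>"
    unfolding G_ab_def args by (simp only: algebra_simps)
  also have "\<dots> = nB * H_ent (real b * \<alpha>) + nA * H_ent (real a * \<alpha>)
    + m * \<alpha> * (ln (real a * real b) + ln t) - m * H_ent \<alpha>"
    unfolding w wp ..
  \<comment> \<open>Compared with the vertex factors, the two vertex entropies leave over
    \<open>- m * \<alpha> * ln b\<close> and \<open>- m * \<alpha> * ln a\<close>, which the term
    with \<open>ln (a * b)\<close> cancels.\<close>
  also have "nB * H_ent (real b * \<alpha>) = - (m * \<alpha> * (ln b + ln \<alpha>)) + nB * ln (bethe_factor \<alpha> b 1) + m * \<alpha> * ln \<alpha>"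
    unfolding mB using \<alpha>0 \<alpha>b assms(2) by (simp add: H ln_bf ln_mult algebra_simps)
  also have "nA * H_ent (real a * \<alpha>) = - (m * \<alpha> * (ln a + ln \<alpha>)) + nA * ln (bethe_factor \<alpha> a 1) + m * \<alpha> * ln \<alpha>"
    unfolding mA using \<alpha>0 \<alpha>a assms(1) by (simp add: H ln_bf ln_mult algebra_simps)
  also have "m * H_ent \<alpha> = - (m * ln ?c) + m * \<alpha> * ln t"
    unfolding ln_c H[OF \<alpha>0 \<alpha>1] by (simp add: algebra_simps)
  also have "ln (real a * real b) = ln a + ln b" using assms(1,2) by (simp add: ln_mult)
  finally have "(nA + nB) * (G_ab a b p + 1 / 2 * p * ln t)
    = m * ln ?c + (nA * ln (bethe_factor \<alpha> a 1) + nB * ln (bethe_factor \<alpha> b 1))"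
    by (simp add: algebra_simps)
  then show ?thesis using lnM v by simp
qed

section \<open>The range below p* and the inverse t(G,p)\<close>

text \<open>If all matchings had at most \<open>p / 2 * card V\<close> edges, the matching
  polynomial would grow no faster than that power of \<open>t\<close>. The lower bound at some
  \<open>r > p\<close> forces faster growth.\<close>

lemma max_matching_gt:
  fixes p :: real
  assumes "0 < a" "0 < b" and graph: "biregular_bipartite V E A B a b" and "V \<noteq> {}"
    and "0 < p" "p * real (a + b) < 2 * real a" "p * real (a + b) < 2 * real b"
  shows "p / 2 * real (card V) < real (max_matching E)"
proof (rule ccontr)
  note finE = biregular_card_edges(1)[OF graph]
  have "finite V" using graph by (simp add: biregular_bipartite_def simple_graph_def)
  then have v: "real (card V) > 0" using assms(4) by (simp add: card_gt_0_iff)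
  define P where "P = 2 * min (real a) (real b) / real (a + b)"
  have "p < P" using assms by (auto simp: P_def min_def field_simps)
  then obtain r where r: "p < r" "r < P" using dense by blast
  have r': "r * real (a + b) < 2 * real a" "r * real (a + b) < 2 * real b"
    using r(2) assms(1,2) by (auto simp: P_def min_def field_simps split: if_splits)
  assume "\<not> p / 2 * real (card V) < real (max_matching E)"
  then have \<nu>: "real (max_matching E) \<le> p / 2 * real (card V)" by simp
  define C where "C = ln (match_poly E 1) - real (card V) * G_ab a b r"
  define \<delta> where "\<delta> = (r - p) / 2 * real (card V)"
  have \<delta>: "\<delta> > 0" using r v by (simp add: \<delta>_def)
  \<comment> \<open>At \<open>t = exp s\<close> the gap in the exponents,
    \<open>\<delta> * s = \<bar>C\<bar> + \<delta>\<close>, exceeds the constant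
    \<open>C\<close>.\<close>
  define s where "s = \<bar>C\<bar> / \<delta> + 1"
  have s: "s > 0" using \<delta> by (simp add: s_def add_nonneg_pos)
  have "real (card V) * (G_ab a b r + r / 2 * s) \<le> ln (match_poly E (exp s))"
    using ln_match_poly_ge[OF assms(1,2) graph _ r', of "exp s"] r assms(5) by simp
  also have "\<dots> \<le> ln (match_poly E 1 * exp s ^ max_matching E)"
    using match_poly_le_power[OF finE, of "exp s"] match_poly_ge_1[OF finE, of "exp s"] s
    by (intro ln_mono) (auto simp: less_le_trans)
  also have "\<dots> = ln (match_poly E 1) + real (max_matching E) * s"
    using match_poly_ge_1[OF finE, of 1] by (simp add: ln_mult ln_realpow)
  also have "\<dots> \<le> ln (match_poly E 1) + p / 2 * real (card V) * s"
    using \<nu> s by simp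
  finally have "\<delta> * s \<le> C" by (simp add: C_def \<delta>_def algebra_simps diff_divide_distrib)
  moreover have "\<delta> * s = \<bar>C\<bar> + \<delta>" using \<delta> by (simp add: s_def field_simps)
  ultimately show False using \<delta> by linarith
qed

text \<open>Uniqueness: dividing by \<open>t powr \<kappa>\<close> turns every summand into a nondecreasing function of \<open>t\<close>.\<close>
lemma centered_poly_unique_root:
  fixes m :: "nat \<Rightarrow> real"
  assumes m: "\<And>k. m k \<ge> 0" "m 0 > 0" "m \<nu> > 0" and \<nu>: "\<nu> \<le> n" "0 < \<kappa>" "\<kappa> < real \<nu>"
  shows "\<exists>!t. t \<ge> 0 \<and> (\<Sum>k\<le>n. (real k - \<kappa>) * m k * t ^ k) = 0"
proof -
  define N where "N t = (\<Sum>k\<le>n. (real k - \<kappa>) * m k * t ^ k)" for t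
  have N0: "N 0 < 0"
  proof -
    have "N 0 = (\<Sum>k\<in>{0}. (real k - \<kappa>) * m k * 0 ^ k)"
      unfolding N_def by (rule sum.mono_neutral_right) auto
    then show ?thesis using m(2) \<nu>(2) by simp
  qed
  define S where "S = (\<Sum>k\<le>n. \<kappa> * m k)"
  \<comment> \<open>Negative terms have \<open>k < \<kappa> < \<nu>\<close>, hence
    \<open>k \<le> \<nu> - 1\<close>; as \<open>T \<ge> 1\<close> they total at least
    \<open>- S * T ^ (\<nu> - 1)\<close>. This \<open>T\<close> is large enough for the term at
    \<open>\<nu>\<close> to outweigh them.\<close>
  define T where "T = 1 + S / ((real \<nu> - \<kappa>) * m \<nu>)"
  have S: "S \<ge> 0" using m(1) \<nu>(2) by (simp add: S_def sum_nonneg)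
  then have T: "T \<ge> 1" using m \<nu> by (simp add: T_def)
  have "\<nu> > 0" using \<nu> by linarith
  have NT: "N T \<ge> 0"
  proof -
    let ?f = "\<lambda>k. if k = \<nu> then (real \<nu> - \<kappa>) * m \<nu> * T ^ \<nu> else 0"
    have "(\<Sum>k\<le>n. ?f k - \<kappa> * m k * T ^ (\<nu> - 1)) \<le> N T"
      unfolding N_def
    proof (rule sum_mono)
      fix k
      have nonneg: "\<kappa> * m k * T ^ (\<nu> - 1) \<ge> 0" using m(1)[of k] \<nu>(2) T by simp
      consider "k = \<nu>" | "k \<noteq> \<nu>" "real k \<ge> \<kappa>" | "real k < \<kappa>" by linarith
      then show "?f k - \<kappa> * m k * T ^ (\<nu> - 1) \<le> (real k - \<kappa>) * m k * T ^ k"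
      proof cases
        case 1
        then show ?thesis using nonneg by simp
      next
        case 2
        have "(real k - \<kappa>) * m k * T ^ k \<ge> 0" using 2 m(1)[of k] T by simp
        then show ?thesis using 2 nonneg by simp
      next
        case 3
        then have "k \<noteq> \<nu>" "k \<le> \<nu> - 1" using \<nu> by linarith+
        then have "m k * T ^ k \<le> m k * T ^ (\<nu> - 1)"
          using m(1)[of k] T by (intro mult_left_mono power_increasing) auto
        then have "\<kappa> * (m k * T ^ k) \<le> \<kappa> * (m k * T ^ (\<nu> - 1))"
          by (rule mult_left_mono[OF _ less_imp_le[OF \<nu>(2)]])
        moreover have "0 \<le> real k * (m k * T ^ k)" using m(1)[of k] T by simp
        ultimately show ?thesis using \<open>k \<noteq> \<nu>\<close> by (simp add: algebra_simps)
      qed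
    qed
    moreover have "(\<Sum>k\<le>n. ?f k - \<kappa> * m k * T ^ (\<nu> - 1))
      = (real \<nu> - \<kappa>) * m \<nu> * T ^ \<nu> - S * T ^ (\<nu> - 1)"
      using \<nu>(1) by (simp add: sum_subtractf S_def sum_distrib_right)
    moreover have "T ^ \<nu> = T * T ^ (\<nu> - 1)"
      using \<open>\<nu> > 0\<close> by (simp add: power_eq_if)
    moreover have "(real \<nu> - \<kappa>) * m \<nu> * T \<ge> S"
      using m \<nu> by (simp add: T_def distrib_left)
    then have "(real \<nu> - \<kappa>) * m \<nu> * T * T ^ (\<nu> - 1) \<ge> S * T ^ (\<nu> - 1)"
      using T by (intro mult_right_mono) auto
    ultimately show ?thesis by (simp add: mult.assoc)
  qed
  have "continuous_on {0..T} N" unfolding N_def by (intro continuous_intros)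
  then obtain t where t: "0 \<le> t" "N t = 0"
    using IVT'[of N 0 0 T] N0 NT T by auto
  have less: "N s / s powr \<kappa> < N r / r powr \<kappa>" if "0 < s" "s < r" for s r
  proof -
    have eq: "N x / x powr \<kappa> = (\<Sum>k\<le>n. (real k - \<kappa>) * m k * x powr (real k - \<kappa>))"
      if "x > 0" for x
      using that by (simp add: N_def sum_divide_distrib powr_diff powr_realpow)
    \<comment> \<open>For \<open>k < \<kappa>\<close> the power decreases but its coefficient is
      negative, so the product still increases.\<close>
    have mono: "(real k - \<kappa>) * s powr (real k - \<kappa>) \<le> (real k - \<kappa>) * r powr (real k - \<kappa>)" for k
    proof (cases "real k \<ge> \<kappa>")
      case True
      then show ?thesis using that by (intro mult_left_mono powr_mono2) auto
    next
      case False
      then have "r powr (real k - \<kappa>) \<le> s powr (real k - \<kappa>)"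
        using that by (intro powr_mono2') auto
      then show ?thesis using False by (intro mult_left_mono_neg) auto
    qed
    have "r powr (- \<kappa>) < s powr (- \<kappa>)" using that \<nu>(2) by (intro powr_less_mono2_neg) auto
    \<comment> \<open>Strictness comes from the constant term, where \<open>m 0 > 0\<close> and the
      exponent is \<open>- \<kappa>\<close>.\<close>
    then have strict: "(real 0 - \<kappa>) * m 0 * s powr (real 0 - \<kappa>) < (real 0 - \<kappa>) * m 0 * r powr (real 0 - \<kappa>)"
      using m(2) \<nu>(2) by simp
    show ?thesis
      unfolding eq[OF \<open>0 < s\<close>] eq[OF order.strict_trans[OF that]]
    proof (rule sum_strict_mono_ex1)
      show "\<forall>k\<in>{..n}. (real k - \<kappa>) * m k * s powr (real k - \<kappa>) \<le> (real k - \<kappa>) * m k * r powr (real k - \<kappa>)"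
        using mult_left_mono[OF mono m(1)] by (simp add: mult_ac)
      show "\<exists>k\<in>{..n}. (real k - \<kappa>) * m k * s powr (real k - \<kappa>) < (real k - \<kappa>) * m k * r powr (real k - \<kappa>)"
        by (rule bexI[of _ 0]) (use strict in simp_all)
    qed auto
  qed
  have "x = t" if "x \<ge> 0" "N x = 0" for x
  proof (rule ccontr)
    have "x > 0" "t > 0" using that t N0 by (metis less_le)+
    moreover assume "x \<noteq> t"
    ultimately show False using less[of x t] less[of t x] that t by (cases "x < t") auto
  qed
  then show ?thesis using t unfolding N_def by blast
qed

text \<open>Clearing the positive denominator gives the polynomial of
  \<open>centered_poly_unique_root\<close> with \<open>\<kappa> = p / 2 * card V\<close>.\<close>

lemma p_fun_eq_iff:
  assumes "finite E" "0 < card V" "0 \<le> t"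
  shows "p_fun V E t = p \<longleftrightarrow>
    (\<Sum>k\<le>card E. (real k - p / 2 * real (card V)) * real (num_matchings E k) * t ^ k) = 0"
proof -
  have "(match_poly E has_field_derivative
      (\<Sum>k\<le>card E. real (num_matchings E k) * (real k * t ^ (k - 1)))) (at t)"
    unfolding match_poly_def[abs_def] by (auto intro!: derivative_eq_intros sum.cong)
  then have "t * deriv (match_poly E) t = (\<Sum>k\<le>card E. t * (real (num_matchings E k) * (real k * t ^ (k - 1))))"
    by (simp add: DERIV_imp_deriv sum_distrib_left)
  also have "\<dots> = (\<Sum>k\<le>card E. real k * real (num_matchings E k) * t ^ k)"
  proof (rule sum.cong[OF refl])
    fix k show "t * (real (num_matchings E k) * (real k * t ^ (k - 1))) = real k * real (num_matchings E k) * t ^ k"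
      by (cases k) auto
  qed
  finally have d: "t * deriv (match_poly E) t = (\<Sum>k\<le>card E. real k * real (num_matchings E k) * t ^ k)" .
  have "(\<Sum>k\<le>card E. (real k - p / 2 * real (card V)) * real (num_matchings E k) * t ^ k)
    = t * deriv (match_poly E) t - p / 2 * real (card V) * match_poly E t"
    unfolding d match_poly_def by (simp add: algebra_simps sum_subtractf sum_distrib_left)
  moreover have "match_poly E t > 0" using match_poly_ge_1[OF assms(1,3)] by linarith
  ultimately show ?thesis using assms(2) by (auto simp: p_fun_def field_simps)
qed

text \<open>The unique root makes the description \<open>THE\<close> in \<open>t_fun\<close>
  meaningful, and the root is not 0 because \<open>p_fun\<close> vanishes there while
  \<open>p > 0\<close>.\<close>

lemma t_fun_pos:
  assumes "finite E" "0 < card V" "0 < p" "p / 2 * real (card V) < real (max_matching E)"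
  shows "t_fun V E p > 0"
proof -
  have "max_matching E \<le> card E"
    using max_matching_attained[OF assms(1)] matching_card_le[OF assms(1)] by metis
  then have "\<exists>!t. t \<ge> 0 \<and>
    (\<Sum>k\<le>card E. (real k - p / 2 * real (card V)) * real (num_matchings E k) * t ^ k) = 0"
    using num_matchings_0[OF assms(1)] num_matchings_max_pos[OF assms(1)] assms
    by (intro centered_poly_unique_root[where \<nu> = "max_matching E"]) auto
  then have "\<exists>!t. t \<ge> 0 \<and> p_fun V E t = p"
    using p_fun_eq_iff[OF assms(1,2)] by (simp cong: conj_cong)
  then have "t_fun V E p \<ge> 0 \<and> p_fun V E (t_fun V E p) = p"
    unfolding t_fun_def by (rule theI')
  moreover have "p_fun V E 0 = 0" by (simp add: p_fun_def)
  ultimately show ?thesis using assms(3) by (metis less_le)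
qed

section \<open>The lower bound for \<open>lambda_G\<close>\<close>

theorem theorem4p6:
  fixes V :: "'v set" and E :: "'v set set" and A B :: "'v set"
    and a b :: nat and p :: real
  assumes "0 < a" and "0 < b"
    and "V \<noteq> {}"
    and "biregular_bipartite V E A B a b"
    and "0 \<le> p"
    and "p \<le> min (real a / real (a + b)) (real b / real (a + b))"
  shows "lambda_G V E p \<ge> G_ab a b p"
proof (cases "p = 0")
  case True
  then show ?thesis by (simp add: lambda_G_def G_ab_def H_ent_def)
next
  case False
  then have p: "0 < p" using assms(5) by simp
  have "p * real (a + b) \<le> real a" "p * real (a + b) \<le> real b"
    using assms(1,2,6) by (simp_all add: pos_le_divide_eq)
  then have lt: "p * real (a + b) < 2 * real a" "p * real (a + b) < 2 * real b"
    using assms(1,2) by simp_all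
  note finE = biregular_card_edges(1)[OF assms(4)]
  have "finite V" using assms(4) by (simp add: biregular_bipartite_def simple_graph_def)
  then have v: "0 < card V" using assms(3) by (simp add: card_gt_0_iff)
  have \<nu>: "p / 2 * real (card V) < real (max_matching E)"
    by (rule max_matching_gt[OF assms(1,2,4,3) p lt])
  \<comment> \<open>The strict inequality selects the open branch of \<open>lambda_G\<close>, so the
    limit at \<open>p_star\<close> does not enter.\<close>
  then have "p < p_star V E" using v by (simp add: p_star_def field_simps)
  then have eq: "lambda_G V E p = lambda_open V E p" using p by (simp add: lambda_G_def)
  let ?t = "t_fun V E p"
  have "ln (match_poly E ?t) \<ge> real (card V) * (G_ab a b p + p / 2 * ln ?t)"
    by (rule ln_match_poly_ge[OF assms(1,2,4) p lt t_fun_pos[OF finE v p \<nu>]])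
  then have "ln (match_poly E ?t) / real (card V) \<ge> G_ab a b p + p / 2 * ln ?t"
    using v by (simp add: pos_le_divide_eq mult.commute)
  then show ?thesis unfolding eq lambda_open_def by simp
qed

end
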